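(* Let $\mathcal L(\Sigma)=\mathbb{ZP}[x_1,x_1',\dots,x_n,x_n']$ be the lower bound associated with a seed $\Sigma$. The standard monomials in $x_1,x_1',\dots,x_n,x_n'$ are linearly independent over $\mathbb{ZP}$ (that is, they form a $\mathbb{ZP}$-basis of $\mathcal L(\Sigma)$) if and only if $\Sigma$ is acyclic.
   Context: Let $\mathbb P$ be a torsion-free abelian group, written multiplicatively, $\mathbb{ZP}$ its integer group ring, $n\ge 1$, and $\mathcal F$ a field isomorphic to the field of rational functions in $n$ independent variables over the fraction field of $\mathbb{ZP}$. A seed in $\mathcal F$ is a triple $\Sigma=(\mathbf x,\mathbf p,B)$ where: $\mathbf x=\{x_1,\dots,x_n\}$ (the cluster) is a transcendence basis of $\mathcal F$ over the fraction field of $\mathbb{ZP}$ (so that $\mathcal F$ is the field of rational functions in $\mathbf x$); $\mathbf p=(p_1^\pm,\dots,p_n^\pm)$ is a $2n$-tuple of elements of $\mathbb P$; $B=(b_{ij})$ is an $n\times n$ integer matrix which is sign-skew-symmetric, i.e. for all $i,j$ either $b_{ij}=b_{ji}=0$ or $b_{ij}b_{ji}<0$. For $j\in\{1,\dots,n\}$ the element $x_j'\in\mathcal F$ is defined by the exchange relation $x_jx_j'=p_j^+\prod_{b_{ij}>0}x_i^{b_{ij}}+p_j^-\prod_{b_{ij}<0}x_i^{-b_{ij}}$. The lower bound $\mathcal L(\Sigma)$ is the $\mathbb{ZP}$-subalgebra of $\mathcal F$ generated by $x_1,x_1',\dots,x_n,x_n'$. A monomial in $x_1,x_1',\dots,x_n,x_n'$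 is standard if it contains no product of the form $x_jx_j'$; the standard monomials always span $\mathcal L(\Sigma)$ over $\mathbb{ZP}$. The seed is acyclic if the directed graph with vertices $1,\dots,n$ and directed edges $(i,j)$ for $b_{ij}>0$ has no oriented cycles. *)

theory Defs
  imports
    "HOL-Library.Poly_Mapping"
    "HOL-Analysis.Finite_Cartesian_Product"
begin

text \<open>
  The coefficient group is a type \<open>'p\<close> of class \<open>ab_group_add\<close>; it is written additively because the
  multiplication of \<open>poly_mapping\<close> is convolution along \<open>+\<close>.  Thus \<open>'p \<Rightarrow>\<^sub>0 int\<close> is the integral
  group ring and the group element \<open>g\<close>, seen in it, is \<open>Poly_Mapping.single g 1\<close>.
  The inclusion of the group ring in the ambient field \<open>'f\<close> is a map \<open>\<iota>\<close>.
  The indices \<open>1,\<dots>,n\<close> are the elements of a finite type \<open>'n\<close>, so \<open>n = CARD('n) \<ge> 1\<close>.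
\<close>

type_synonym 'p group_ring = "'p \<Rightarrow>\<^sub>0 int"

definition fraction_field :: "('p::ab_group_add group_ring \<Rightarrow> 'f::field) \<Rightarrow> 'f set" where
  "fraction_field \<iota> = {\<iota> a / \<iota> b |a b. b \<noteq> 0}"

definition is_subfield :: "'f::field set \<Rightarrow> bool" where
  "is_subfield S \<longleftrightarrow> 1 \<in> S \<and>
     (\<forall>a\<in>S. \<forall>b\<in>S. a - b \<in> S \<and> a * b \<in> S) \<and> (\<forall>a\<in>S. inverse a \<in> S)"

definition poly_eval :: "('n::finite \<Rightarrow> 'f::field) \<Rightarrow> (('n \<Rightarrow>\<^sub>0 nat) \<Rightarrow>\<^sub>0 'f) \<Rightarrow> 'f" where
  "poly_eval x q =
     (\<Sum>m\<in>Poly_Mapping.keys q.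
        Poly_Mapping.lookup q m * (\<Prod>i\<in>UNIV. x i ^ Poly_Mapping.lookup m i))"

definition algebraically_independent :: "'f::field set \<Rightarrow> ('n::finite \<Rightarrow> 'f) \<Rightarrow> bool" where
  "algebraically_independent K x \<longleftrightarrow>
     (\<forall>q. range (Poly_Mapping.lookup q) \<subseteq> K \<longrightarrow> poly_eval x q = 0 \<longrightarrow> q = 0)"

definition sign_skew_symmetric :: "int ^ 'n ^ 'n \<Rightarrow> bool" where
  "sign_skew_symmetric B \<longleftrightarrow>
     (\<forall>i j. (B $ i $ j = 0 \<and> B $ j $ i = 0) \<or> B $ i $ j * B $ j $ i < 0)"

record ('p, 'f, 'n) seed_data =
  cluster :: "'n \<Rightarrow> 'f"
  p_plus :: "'n \<Rightarrow> 'p"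
  p_minus :: "'n \<Rightarrow> 'p"
  exchange_matrix :: "int ^ 'n ^ 'n"

text \<open>
  The assumptions \<open>cluster_independent\<close> and \<open>cluster_generates\<close> say that the cluster is a
  transcendence basis over the fraction field and that the ambient field is the field of rational
  functions in the cluster; in particular the ambient field is isomorphic to the field of rational
  functions in \<open>CARD('n)\<close> variables over the fraction field.
\<close>

locale seed =
  fixes \<iota> :: "'p::ab_group_add group_ring \<Rightarrow> 'f::field"
    and \<Sigma> :: "('p, 'f, 'n::finite) seed_data"
  assumes torsion_free: "\<And>(g::'p) (k::nat). k > 0 \<Longrightarrow> (\<Sum>i<k. g) = 0 \<Longrightarrow> g = 0"
    and embed_add: "\<And>a b. \<iota> (a + b) = \<iota> a + \<iota> b"
    and embed_mult: "\<And>a b. \<iota> (a * b) = \<iota> a * \<iota> b"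
    and embed_one: "\<iota> 1 = 1"
    and embed_inj: "inj \<iota>"
    and cluster_independent: "algebraically_independent (fraction_field \<iota>) (cluster \<Sigma>)"
    and cluster_generates: "is_subfield hull (fraction_field \<iota> \<union> range (cluster \<Sigma>)) = UNIV"
    and sign_skew: "sign_skew_symmetric (exchange_matrix \<Sigma>)"

text \<open>The element \<open>x\<^sub>j'\<close>: the exchange relation solved for it (\<open>x\<^sub>j \<noteq> 0\<close> in a seed).\<close>

definition exchanged ::
  "('p::ab_group_add group_ring \<Rightarrow> 'f::field) \<Rightarrow> ('p, 'f, 'n::finite) seed_data \<Rightarrow> 'n \<Rightarrow> 'f" where
  "exchanged \<iota> \<Sigma> j =
     (let x = cluster \<Sigma>; B = exchange_matrix \<Sigma> in
       (\<iota> (Poly_Mapping.single (p_plus \<Sigma> j) 1) * (\<Prod>i | B $ i $ j > 0. x i ^ nat (B $ i $ j)) +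
        \<iota> (Poly_Mapping.single (p_minus \<Sigma> j) 1) * (\<Prod>i | B $ i $ j < 0. x i ^ nat (- (B $ i $ j))))
       / x j)"

lemma (in seed) exchange_relation:
  "cluster \<Sigma> j * exchanged \<iota> \<Sigma> j =
     \<iota> (Poly_Mapping.single (p_plus \<Sigma> j) 1) *
       (\<Prod>i | exchange_matrix \<Sigma> $ i $ j > 0. cluster \<Sigma> i ^ nat (exchange_matrix \<Sigma> $ i $ j)) +
     \<iota> (Poly_Mapping.single (p_minus \<Sigma> j) 1) *
       (\<Prod>i | exchange_matrix \<Sigma> $ i $ j < 0. cluster \<Sigma> i ^ nat (- (exchange_matrix \<Sigma> $ i $ j)))"
proof -
  let ?m = "Poly_Mapping.single j (1::nat)" and ?x = "cluster \<Sigma>"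
  have "\<iota> 0 = 0"
    by (metis add_0 add_cancel_right_left embed_add)
  then have 0: "0 \<in> fraction_field \<iota>" and 1: "1 \<in> fraction_field \<iota>"
    unfolding fraction_field_def using embed_one
    by (auto intro: exI[of _ 1]) (metis div_by_1 zero_neq_one, metis div_by_1 zero_neq_one)
  have "range (Poly_Mapping.lookup (Poly_Mapping.single ?m (1::'f))) \<subseteq> fraction_field \<iota>"
    using 0 1 by (auto simp: lookup_single when_def)
  moreover have "(\<Prod>i\<in>UNIV. ?x i ^ Poly_Mapping.lookup ?m i) = ?x j"
    by (subst prod.remove[of _ j]) (auto simp: lookup_single when_def intro!: prod.neutral)
  then have "poly_eval ?x (Poly_Mapping.single ?m 1) = ?x j"
    by (simp add: poly_eval_def)
  ultimately have "?x j \<noteq> 0"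
    using cluster_independent
    by (metis algebraically_independent_def lookup_single_eq lookup_zero zero_neq_one)
  then show ?thesis
    by (simp add: exchanged_def Let_def)
qed

definition is_subalgebra :: "('p::ab_group_add group_ring \<Rightarrow> 'f::field) \<Rightarrow> 'f set \<Rightarrow> bool" where
  "is_subalgebra \<iota> S \<longleftrightarrow> range \<iota> \<subseteq> S \<and> (\<forall>a\<in>S. \<forall>b\<in>S. a + b \<in> S \<and> a * b \<in> S)"

definition lower_bound ::
  "('p::ab_group_add group_ring \<Rightarrow> 'f::field) \<Rightarrow> ('p, 'f, 'n::finite) seed_data \<Rightarrow> 'f set" where
  "lower_bound \<iota> \<Sigma> = is_subalgebra \<iota> hull (range (cluster \<Sigma>) \<union> range (exchanged \<iota> \<Sigma>))"

text \<open>
  Monomials are formal: the pair \<open>(a, b)\<close> of exponent vectors stands for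
  \<open>\<Prod>\<^sub>j x\<^sub>j ^ a\<^sub>j * x\<^sub>j' ^ b\<^sub>j\<close>, whose value is given by \<open>monomial_value\<close>.
\<close>

definition standard_monomials :: "(('n \<Rightarrow> nat) \<times> ('n \<Rightarrow> nat)) set" where
  "standard_monomials = {(a, b). \<forall>j. \<not> (a j > 0 \<and> b j > 0)}"

definition monomial_value ::
  "('p::ab_group_add group_ring \<Rightarrow> 'f::field) \<Rightarrow> ('p, 'f, 'n::finite) seed_data
     \<Rightarrow> ('n \<Rightarrow> nat) \<times> ('n \<Rightarrow> nat) \<Rightarrow> 'f" where
  "monomial_value \<iota> \<Sigma> = (\<lambda>(a, b). \<Prod>j\<in>UNIV. cluster \<Sigma> j ^ a j * exchanged \<iota> \<Sigma> j ^ b j)"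

abbreviation scale_by :: "('p::ab_group_add group_ring \<Rightarrow> 'f::field) \<Rightarrow> 'p group_ring \<Rightarrow> 'f \<Rightarrow> 'f" where
  "scale_by \<iota> \<equiv> \<lambda>r f. \<iota> r * f"

lemma (in seed) module_scale_by: "module (scale_by \<iota>)"
  by unfold_locales (simp_all add: embed_add embed_mult embed_one algebra_simps)

text \<open>
  \<open>module.dependent\<close> is about sets.  Linear independence is meant for the family indexed by the
  formal monomials, so two monomials with the same value count as a dependence: hence \<open>inj_on\<close>.
\<close>

definition standard_monomials_independent ::
  "('p::ab_group_add group_ring \<Rightarrow> 'f::field) \<Rightarrow> ('p, 'f, 'n::finite) seed_data \<Rightarrow> bool" where
  "standard_monomials_independent \<iota> \<Sigma> \<longleftrightarrow>
     inj_on (monomial_value \<iota> \<Sigma>) standard_monomials \<and>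
     \<not> module.dependent (scale_by \<iota>) (monomial_value \<iota> \<Sigma> ` standard_monomials)"

definition standard_monomials_basis ::
  "('p::ab_group_add group_ring \<Rightarrow> 'f::field) \<Rightarrow> ('p, 'f, 'n::finite) seed_data \<Rightarrow> bool" where
  "standard_monomials_basis \<iota> \<Sigma> \<longleftrightarrow>
     standard_monomials_independent \<iota> \<Sigma> \<and>
     module.span (scale_by \<iota>) (monomial_value \<iota> \<Sigma> ` standard_monomials) = lower_bound \<iota> \<Sigma>"

definition acyclic_seed :: "('p, 'f, 'n::finite) seed_data \<Rightarrow> bool" where
  "acyclic_seed \<Sigma> \<longleftrightarrow> acyclic {(i, j). exchange_matrix \<Sigma> $ i $ j > 0}"

end

theory Submission
  imports Defs
begin

text \<open>
  Each exchanged variable is a sum \<open>x'\<^sub>j = y\<^sup>+\<^sub>j + y\<^sup>-\<^sub>j\<close> of two Laurent monomials with denominator \<open>x\<^sub>j\<close>.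
  The numerator of \<open>y\<^sup>+\<^sub>j\<close> involves the predecessors of \<open>j\<close> in the graph and that of \<open>y\<^sup>-\<^sub>j\<close> its
  successors.

  Spanning is independent of the shape of the graph: the exchange relation rewrites \<open>x\<^sub>j x'\<^sub>j\<close> into a
  polynomial in the cluster, lowering the degree in the exchanged variables
  (\<open>straightening\<close>, \<open>standard_monomials_span_lower_bound\<close>).  So being a basis and being independent are
  the same condition.

  Suppose there is an oriented cycle.  For an edge from \<open>j\<close> to \<open>k\<close> the product \<open>y\<^sup>-\<^sub>j y\<^sup>+\<^sub>k\<close> has no
  denominator.  In the expansion of \<open>\<Prod> x'\<^sub>j\<close> over the cycle, every choice of signs other than the
  two constant ones contains such a product for two cyclically neighbouring indices, and the two
  constant choices have no denominator either, as the \<open>x\<^sub>j\<close> cancel around the cycle.  To turn this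
  into an identity between monomials in the \<open>x\<^sub>j\<close> and \<open>x'\<^sub>j\<close>, the cycle is cut open and the sum of the
  choices without such a product along the resulting list (\<open>ladder\<close>) is evaluated in two ways.  The
  outcome is that \<open>\<Prod> x'\<^sub>j\<close>, a standard monomial, is a combination of monomials of smaller
  degree in the exchanged variables (\<open>closed_walk_reduction\<close>); straightening these gives a dependence.

  Suppose the graph is acyclic.  Comparing exponent vectors lexicographically along the graph, one
  of the two terms of \<open>x'\<^sub>j\<close> is the smaller one, and its exponent is \<open>-1\<close> at \<open>j\<close> and otherwise supported
  after \<open>j\<close>.  The leading exponents of standard monomials are then obtained by a triangular
  recipe, hence are pairwise distinct (\<open>inj_on_monomial_exponent\<close>), and a nontrivial relation would
  leave a leading term uncancelled (\<open>linear_relation_trivial\<close>).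
\<close>

section \<open>Finitely supported functions, closed walks and list counts\<close>

lemma single_eq_0_iff: "Poly_Mapping.single g c = 0 \<longleftrightarrow> c = 0"
  by (auto simp: poly_mapping_eq_iff fun_eq_iff lookup_single when_def)

lemma sum_singles: "p = (\<Sum>k\<in>Poly_Mapping.keys p. Poly_Mapping.single k (Poly_Mapping.lookup p k))"
  by (rule poly_mapping_eqI)
    (auto simp: lookup_sum lookup_single when_def in_keys_iff sum.delta')

lemma mult_eq_sum_singles:
  "p * q = (\<Sum>(\<alpha>, \<beta>)\<in>Poly_Mapping.keys p \<times> Poly_Mapping.keys q.
      Poly_Mapping.single (\<alpha> + \<beta>) (Poly_Mapping.lookup p \<alpha> * Poly_Mapping.lookup q \<beta>))"
  by (subst (1) sum_singles[of p], subst (1) sum_singles[of q])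
    (simp add: sum_product sum.cartesian_product mult_single)

lemma sum_count_list_UNIV: "(\<Sum>j\<in>UNIV. count_list js j) = length js" for js :: "'a::finite list"
proof (induction js)
  case (Cons k js)
  then show ?case
    using sum.remove[of UNIV k "count_list (k # js)"] sum.remove[of UNIV k "count_list js"] by simp
qed simp

lemma walk_of_trancl:
  "(a, c) \<in> {(i, j). r i j}\<^sup>+ \<Longrightarrow> \<exists>js. js \<noteq> [] \<and> last js = c \<and> successively r (a # js)"
proof (induction rule: trancl_induct)
  case (base c)
  then show ?case by (intro exI[of _ "[c]"]) auto
next
  case (step c d)
  then obtain js where "js \<noteq> []" "last js = c" "successively r (a # js)" by blast
  with step show ?case
    by (intro exI[of _ "js @ [d]"]) (auto simp: successively_append_iff successively_Cons)
qed

section \<open>The two Laurent monomials of an exchanged variable\<close>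

context seed
begin

interpretation scalars: module "scale_by \<iota>"
  by (rule module_scale_by)

abbreviation x :: "'n \<Rightarrow> 'f" where "x \<equiv> cluster \<Sigma>"
abbreviation x' :: "'n \<Rightarrow> 'f" where "x' \<equiv> exchanged \<iota> \<Sigma>"
abbreviation b :: "'n \<Rightarrow> 'n \<Rightarrow> int" where "b i j \<equiv> exchange_matrix \<Sigma> $ i $ j"
abbreviation val :: "('n \<Rightarrow> nat) \<times> ('n \<Rightarrow> nat) \<Rightarrow> 'f" where "val \<equiv> monomial_value \<iota> \<Sigma>"
abbreviation edge :: "'n \<Rightarrow> 'n \<Rightarrow> bool" where "edge i j \<equiv> b i j > 0"

lemma embed_zero: "\<iota> 0 = 0"
  by (metis add_0 add_cancel_right_left embed_add)

lemma embed_eq_0_iff: "\<iota> r = 0 \<longleftrightarrow> r = 0"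
  using embed_inj embed_zero by (metis injD)

lemma embed_uminus: "\<iota> (- r) = - \<iota> r"
  by (metis add.right_inverse embed_add embed_zero minus_unique)

text \<open>
  The group ring of a torsion-free abelian group has no zero divisors; here this is inherited from
  the field in which it is embedded.
\<close>

lemma group_ring_mult_eq_0: "r * s = 0 \<Longrightarrow> r = 0 \<or> s = 0" for r s :: "'p group_ring"
  by (metis embed_eq_0_iff embed_mult mult_eq_0_iff)

lemma embed_in_fraction_field: "\<iota> r \<in> fraction_field \<iota>"
proof -
  have "\<iota> r = \<iota> r / \<iota> 1" by (simp add: embed_one)
  then show ?thesis unfolding fraction_field_def by (metis (mono_tags, lifting) mem_Collect_eq zero_neq_one)
qed

lemma cluster_nonzero: "x j \<noteq> 0"
proof
  assume "x j = 0"
  let ?m = "Poly_Mapping.single j (1::nat)"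
  have "range (Poly_Mapping.lookup (Poly_Mapping.single ?m (1::'f))) \<subseteq> fraction_field \<iota>"
    using embed_in_fraction_field[of 0] embed_in_fraction_field[of 1]
    by (auto simp: lookup_single when_def embed_zero embed_one)
  moreover have "(\<Prod>i\<in>UNIV. x i ^ Poly_Mapping.lookup ?m i) = x j"
    by (subst prod.remove[of _ j]) (auto simp: lookup_single when_def intro!: prod.neutral)
  then have "poly_eval x (Poly_Mapping.single ?m 1) = 0"
    using \<open>x j = 0\<close> by (simp add: poly_eval_def)
  ultimately show False
    using cluster_independent
    by (metis algebraically_independent_def lookup_single_eq lookup_zero zero_neq_one)
qed

lemma sign_skew_cases: "b i j = 0 \<and> b j i = 0 \<or> b i j * b j i < 0"
  using sign_skew unfolding sign_skew_symmetric_def by blast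

lemma no_loops: "b j j = 0"
  using sign_skew_cases[of j j] by (auto simp: mult_less_0_iff)

lemma neg_entry_iff: "b i j < 0 \<longleftrightarrow> edge j i"
  using sign_skew_cases[of i j] by (auto simp: mult_less_0_iff)

definition laurent :: "int ^ 'n \<Rightarrow> 'f" where
  "laurent \<alpha> = (\<Prod>i\<in>UNIV. x i powi (\<alpha> $ i))"

lemma laurent_0 [simp]: "laurent 0 = 1"
  by (simp add: laurent_def)

lemma laurent_nonzero [simp]: "laurent \<alpha> \<noteq> 0"
  by (simp add: laurent_def cluster_nonzero)

lemma laurent_add: "laurent (\<alpha> + \<beta>) = laurent \<alpha> * laurent \<beta>"
  by (simp add: laurent_def power_int_add cluster_nonzero prod.distrib)

lemma laurent_diff: "laurent (\<alpha> - \<beta>) = laurent \<alpha> / laurent \<beta>"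
  by (metis diff_add_cancel laurent_add laurent_nonzero nonzero_mult_div_cancel_right)

lemma laurent_axis [simp]: "laurent (axis j 1) = x j"
  by (simp add: laurent_def axis_def prod.remove[of _ j])

lemma laurent_nonneg:
  assumes "\<And>i. 0 \<le> \<alpha> $ i"
  shows "laurent \<alpha> = (\<Prod>i\<in>UNIV. x i ^ nat (\<alpha> $ i))"
  using assms by (simp add: laurent_def power_int_def)

definition plus_exponent :: "'n \<Rightarrow> int ^ 'n" where
  "plus_exponent j = (\<chi> i. max (b i j) 0)"

definition minus_exponent :: "'n \<Rightarrow> int ^ 'n" where
  "minus_exponent j = (\<chi> i. max (- b i j) 0)"

text \<open>
  The exchanged variable is the sum of the two terms \<open>y_plus j\<close> and \<open>y_minus j\<close>, each a single Laurent
  monomial in the cluster up to a unit of the group ring.  Both directions of the theorem are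
  about the interplay of these two terms.
\<close>

definition y_plus :: "'n \<Rightarrow> 'f" where
  "y_plus j = \<iota> (Poly_Mapping.single (p_plus \<Sigma> j) 1) * laurent (plus_exponent j - axis j 1)"

definition y_minus :: "'n \<Rightarrow> 'f" where
  "y_minus j = \<iota> (Poly_Mapping.single (p_minus \<Sigma> j) 1) * laurent (minus_exponent j - axis j 1)"

lemma exchanged_eq: "x' j = y_plus j + y_minus j"
proof -
  have "(\<Prod>i | b i j > 0. x i ^ nat (b i j)) = laurent (plus_exponent j)"
    by (subst laurent_nonneg, simp add: plus_exponent_def)
      (rule prod.mono_neutral_cong_left; simp add: plus_exponent_def max_def)
  moreover have "(\<Prod>i | b i j < 0. x i ^ nat (- b i j)) = laurent (minus_exponent j)"
    by (subst laurent_nonneg, simp add: minus_exponent_def)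
      (rule prod.mono_neutral_cong_left; simp add: minus_exponent_def max_def)
  ultimately show ?thesis
    by (simp add: exchanged_def Let_def y_plus_def y_minus_def laurent_diff add_divide_distrib)
qed

lemma y_minus_nonzero: "y_minus j \<noteq> 0"
  by (simp add: y_minus_def embed_eq_0_iff single_eq_0_iff)

text \<open>
  These are the Laurent terms without denominators, so they lie in the lower bound and have degree
  \<open>0\<close> in the exchanged variables.
\<close>

definition polynomial_term :: "'f \<Rightarrow> bool" where
  "polynomial_term f \<longleftrightarrow> (\<exists>r \<alpha>. (\<forall>i. 0 \<le> \<alpha> $ i) \<and> f = \<iota> r * laurent \<alpha>)"

lemma polynomial_termI: "(\<And>i. 0 \<le> \<alpha> $ i) \<Longrightarrow> polynomial_term (\<iota> r * laurent \<alpha>)"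
  unfolding polynomial_term_def by blast

lemma polynomial_term_1: "polynomial_term 1"
  using polynomial_termI[of 0 1] by (simp add: embed_one)

lemma polynomial_term_mult:
  assumes "polynomial_term f" and "polynomial_term g"
  shows "polynomial_term (f * g)"
proof -
  obtain r \<alpha> s \<beta> where nonneg: "\<And>i. 0 \<le> \<alpha> $ i" "\<And>i. 0 \<le> \<beta> $ i"
    and eqs: "f = \<iota> r * laurent \<alpha>" "g = \<iota> s * laurent \<beta>"
    using assms unfolding polynomial_term_def by blast
  have "f * g = \<iota> (r * s) * laurent (\<alpha> + \<beta>)"
    unfolding eqs laurent_add embed_mult by (simp only: mult_ac)
  then show ?thesis
    using polynomial_termI[of "\<alpha> + \<beta>" "r * s"] nonneg by simp
qed

section \<open>Products along closed walks have no denominators\<close>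

text \<open>
  The numerator of \<open>y_plus j\<close> is divisible by \<open>x k\<close> for every predecessor \<open>k\<close> of \<open>j\<close>, and that of
  \<open>y_minus j\<close> by \<open>x k\<close> for every successor \<open>k\<close>.  Written without division, a step along an edge
  trades \<open>x j\<close> for \<open>x k\<close>, and such steps telescope along a walk.
\<close>

lemma y_plus_edge:
  assumes "edge k j"
  obtains m where "polynomial_term m" and "y_plus j * x j = m * x k"
proof
  let ?m = "\<iota> (Poly_Mapping.single (p_plus \<Sigma> j) 1) * laurent (plus_exponent j - axis k 1)"
  show "polynomial_term ?m"
    using assms by (intro polynomial_termI) (auto simp: plus_exponent_def axis_def)
  show "y_plus j * x j = ?m * x k"
    by (simp add: y_plus_def laurent_diff cluster_nonzero)
qed

lemma y_minus_edge:
  assumes "edge j k"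
  obtains m where "polynomial_term m" and "y_minus j * x j = m * x k"
proof
  have "b k j < 0" using assms neg_entry_iff by blast
  let ?m = "\<iota> (Poly_Mapping.single (p_minus \<Sigma> j) 1) * laurent (minus_exponent j - axis k 1)"
  show "polynomial_term ?m"
    using \<open>b k j < 0\<close> by (intro polynomial_termI) (auto simp: minus_exponent_def axis_def)
  show "y_minus j * x j = ?m * x k"
    by (simp add: y_minus_def laurent_diff cluster_nonzero)
qed

text \<open>
  Across an edge the denominators \<open>x j\<close> and \<open>x k\<close> of the two factors cancel against each other's
  numerators.
\<close>

lemma y_minus_y_plus_edge:
  assumes "edge j k"
  shows "polynomial_term (y_minus j * y_plus k)"
proof -
  obtain m m' where "polynomial_term m" "y_minus j * x j = m * x k"
    and "polynomial_term m'" "y_plus k * x k = m' * x j"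
    using assms y_plus_edge y_minus_edge by metis
  moreover from this have "y_minus j * y_plus k * (x j * x k) = m * m' * (x j * x k)"
    by (metis (no_types, lifting) mult.assoc mult.commute)
  ultimately show ?thesis
    using polynomial_term_mult[of m m'] cluster_nonzero by simp
qed

lemma prod_y_plus_walk:
  "successively edge (a # js) \<Longrightarrow>
     \<exists>m. polynomial_term m \<and> (\<Prod>j\<leftarrow>js. y_plus j) * x (last (a # js)) = m * x a"
proof (induction js arbitrary: a)
  case Nil
  then show ?case using polynomial_term_1 by auto
next
  case (Cons k js)
  obtain m where m: "polynomial_term m" "(\<Prod>j\<leftarrow>js. y_plus j) * x (last (k # js)) = m * x k"
    using Cons by auto
  obtain m' where m': "polynomial_term m'" "y_plus k * x k = m' * x a"
    using Cons.prems y_plus_edge by auto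
  have "(\<Prod>j\<leftarrow>k # js. y_plus j) * x (last (a # k # js)) = y_plus k * (m * x k)"
    using m(2) by (simp add: mult.assoc)
  also have "\<dots> = m * m' * x a" using m'(2) by (simp add: ac_simps)
  finally show ?case using polynomial_term_mult[OF m(1) m'(1)] by blast
qed

lemma prod_y_minus_walk:
  "successively edge (a # js) \<Longrightarrow>
     \<exists>m. polynomial_term m \<and>
       (\<Prod>j\<leftarrow>a # js. y_minus j) * x a = m * (y_minus (last (a # js)) * x (last (a # js)))"
proof (induction js arbitrary: a)
  case Nil
  then show ?case using polynomial_term_1 by (auto intro!: exI[of _ 1])
next
  case (Cons k js)
  let ?l = "last (k # js)"
  obtain m where m: "polynomial_term m"
      "(\<Prod>j\<leftarrow>k # js. y_minus j) * x k = m * (y_minus ?l * x ?l)"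
    using Cons by (metis successively.simps(3))
  obtain m' where m': "polynomial_term m'" "y_minus a * x a = m' * x k"
    using Cons.prems y_minus_edge by auto
  have "(\<Prod>j\<leftarrow>a # k # js. y_minus j) * x a = (y_minus a * x a) * (\<Prod>j\<leftarrow>k # js. y_minus j)"
    by (simp add: ac_simps)
  also have "\<dots> = m' * ((\<Prod>j\<leftarrow>k # js. y_minus j) * x k)" using m'(2) by (simp add: ac_simps)
  also have "\<dots> = m' * m * (y_minus ?l * x ?l)" unfolding m(2) by (simp add: ac_simps)
  finally show ?case using polynomial_term_mult[OF m'(1) m(1)]
    by (metis last_ConsR list.distinct(1))
qed

lemma closed_walk_products:
  assumes "successively edge (a # js)" and "js \<noteq> []" and "last js = a"
  shows "polynomial_term (\<Prod>j\<leftarrow>js. y_plus j)" and "polynomial_term (\<Prod>j\<leftarrow>js. y_minus j)"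
proof -
  obtain m where "polynomial_term m" "(\<Prod>j\<leftarrow>js. y_plus j) * x a = m * x a"
    using prod_y_plus_walk[OF assms(1)] assms by auto
  then show "polynomial_term (\<Prod>j\<leftarrow>js. y_plus j)" using cluster_nonzero by simp
  obtain m where "polynomial_term m"
      "(\<Prod>j\<leftarrow>a # js. y_minus j) * x a = m * (y_minus a * x a)"
    using prod_y_minus_walk[OF assms(1)] assms by auto
  then show "polynomial_term (\<Prod>j\<leftarrow>js. y_minus j)"
    using cluster_nonzero y_minus_nonzero by simp
qed

section \<open>Filtration by the degree in the exchanged variables\<close>

text \<open>
  The bound is strict, so that \<open>low_degree 0\<close> is zero and no subtraction on natural numbers is
  needed for the degree of a remainder.
\<close>

definition low_degree :: "nat \<Rightarrow> 'f set" where
  "low_degree d = scalars.span (val ` {(a, c). sum c UNIV < d})"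

lemma low_degree_mono: "d \<le> e \<Longrightarrow> low_degree d \<subseteq> low_degree e"
  unfolding low_degree_def by (rule scalars.span_mono) auto

lemma low_degree_add: "f \<in> low_degree d \<Longrightarrow> g \<in> low_degree d \<Longrightarrow> f + g \<in> low_degree d"
  unfolding low_degree_def by (rule scalars.span_add)

lemma low_degree_diff: "f \<in> low_degree d \<Longrightarrow> g \<in> low_degree d \<Longrightarrow> f - g \<in> low_degree d"
  unfolding low_degree_def by (rule scalars.span_diff)

lemma val_mult:
  "val (a, c) * val (a', c') = val (\<lambda>j. a j + a' j, \<lambda>j. c j + c' j)"
  by (simp add: monomial_value_def prod.distrib[symmetric] power_add ac_simps)

lemma laurent_nonneg_val: "(\<And>i. 0 \<le> \<alpha> $ i) \<Longrightarrow> laurent \<alpha> = val (\<lambda>i. nat (\<alpha> $ i), \<lambda>_. 0)"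
  by (simp add: laurent_nonneg monomial_value_def)

lemma exchanged_val: "x' j = val (\<lambda>_. 0, \<lambda>i. if i = j then 1 else 0)"
  by (simp add: monomial_value_def prod.remove[of _ j])

lemma cluster_val: "x j = val (\<lambda>i. if i = j then 1 else 0, \<lambda>_. 0)"
  by (simp add: monomial_value_def prod.remove[of _ j])

text \<open>
  Multiplication by \<open>f\<close> is linear, so it suffices to look at generators.
\<close>

lemma mult_span_closed:
  assumes "\<And>s. s \<in> S \<Longrightarrow> f * s \<in> scalars.span T" and "v \<in> scalars.span S"
  shows "f * v \<in> scalars.span T"
  using assms(2)
proof (induction rule: scalars.span_induct_alt)
  case base
  then show ?case by (simp add: scalars.span_zero)
next
  case (step r s v)
  have "f * (\<iota> r * s + v) = \<iota> r * (f * s) + f * v" by (simp add: algebra_simps)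
  then show ?case using step assms(1) by (simp add: scalars.span_add scalars.span_scale)
qed

lemma exchanged_mult_low_degree:
  assumes "v \<in> low_degree d"
  shows "x' j * v \<in> low_degree (Suc d)"
  using _ assms unfolding low_degree_def
proof (rule mult_span_closed)
  fix s assume "s \<in> val ` {(a, c). sum c UNIV < d}"
  then obtain a c where "s = val (a, c)" and "sum c UNIV < d" by auto
  then show "x' j * s \<in> scalars.span (val ` {(a, c). sum c UNIV < Suc d})"
    by (auto simp: exchanged_val val_mult sum.distrib intro!: scalars.span_base imageI)
qed

lemma polynomial_term_mult_low_degree:
  assumes "polynomial_term f" and "v \<in> low_degree d"
  shows "f * v \<in> low_degree d"
  using _ assms(2) unfolding low_degree_def
proof (rule mult_span_closed)
  fix s assume "s \<in> val ` {(a, c). sum c UNIV < d}"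
  then obtain a c where s: "s = val (a, c)" and "sum c UNIV < d" by auto
  obtain r \<alpha> where \<alpha>: "\<forall>i. 0 \<le> \<alpha> $ i" and f: "f = \<iota> r * laurent \<alpha>"
    using assms(1) unfolding polynomial_term_def by blast
  have "f * s = \<iota> r * val (\<lambda>i. nat (\<alpha> $ i) + a i, c)"
    using \<alpha> by (simp add: f s laurent_nonneg_val val_mult mult.assoc)
  moreover have "val (\<lambda>i. nat (\<alpha> $ i) + a i, c) \<in> scalars.span (val ` {(a, c). sum c UNIV < d})"
    using \<open>sum c UNIV < d\<close> by (auto intro!: scalars.span_base imageI)
  ultimately show "f * s \<in> scalars.span (val ` {(a, c). sum c UNIV < d})"
    by (simp add: scalars.span_scale)
qed

lemma one_low_degree: "1 \<in> low_degree (Suc 0)"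
  unfolding low_degree_def
  by (rule scalars.span_base) (auto simp: monomial_value_def image_iff intro!: exI[of _ "\<lambda>_. 0"])

lemma polynomial_term_low_degree: "polynomial_term f \<Longrightarrow> f \<in> low_degree (Suc 0)"
  using polynomial_term_mult_low_degree[OF _ one_low_degree] by simp

section \<open>The product over a closed walk has lower degree than it seems\<close>

text \<open>
  Expand the product of \<open>x' j = y_plus j + y_minus j\<close> along a list of indices.  The ladder keeps the
  words in which a minus is never directly followed by a plus, that is, the words consisting of
  pluses followed by minuses.  The words left out contain a factor \<open>y_minus j * y_plus k\<close> for
  neighbours \<open>j\<close>, \<open>k\<close>; if these are joined by an edge, that factor is a polynomial term.
\<close>

fun ladder :: "'n list \<Rightarrow> 'f" where
  "ladder [] = 1"
| "ladder (j # js) = y_plus j * ladder js + (\<Prod>i\<leftarrow>j # js. y_minus i)"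

text \<open>
  Prepending \<open>j\<close> with either sign is multiplication by \<open>x' j\<close>; it overshoots exactly by the words
  beginning with minus, plus.  This is the three-term recurrence of a tridiagonal determinant, and
  along a walk it shows that the ladder is a polynomial in the cluster and exchanged variables.
\<close>

lemma ladder_recurrence:
  "ladder (j # k # js) = x' j * ladder (k # js) - y_minus j * y_plus k * ladder js"
  by (simp add: exchanged_eq algebra_simps)

text \<open>
  The only word of a ladder ending with a plus is the one without minuses.  Combined with the
  defining equation, which singles out the first index, this controls both ends of a list.
\<close>

lemma ladder_snoc:
  "ladder (js @ [k]) = ladder js * y_minus k + (\<Prod>j\<leftarrow>js @ [k]. y_plus j)"
  by (induction js) (simp_all add: algebra_simps)

text \<open>
  By the recurrence, every correction replaces two exchanged variables by a polynomial term, so the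
  ladder and the full product differ by terms of smaller degree.
\<close>

lemma ladder_leading_term:
  "successively edge js \<Longrightarrow>
     (\<Prod>j\<leftarrow>js. x' j) \<in> low_degree (Suc (length js)) \<and>
     ladder js - (\<Prod>j\<leftarrow>js. x' j) \<in> low_degree (length js)"
proof (induction js rule: induct_list012)
  case 1
  then show ?case using one_low_degree by (simp add: low_degree_def scalars.span_zero)
next
  case (2 j)
  then show ?case using exchanged_mult_low_degree[OF one_low_degree, of j]
    by (simp add: exchanged_eq low_degree_def scalars.span_zero)
next
  case (3 j k js)
  have IH1: "(\<Prod>j\<leftarrow>js. x' j) \<in> low_degree (Suc (length js))"
      "ladder js - (\<Prod>j\<leftarrow>js. x' j) \<in> low_degree (length js)"
    and IH2: "(\<Prod>j\<leftarrow>k # js. x' j) \<in> low_degree (Suc (length (k # js)))"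
      "ladder (k # js) - (\<Prod>j\<leftarrow>k # js. x' j) \<in> low_degree (length (k # js))"
    using 3 by (cases js; simp)+
  have "(ladder js - (\<Prod>j\<leftarrow>js. x' j)) + (\<Prod>j\<leftarrow>js. x' j) \<in> low_degree (Suc (length js))"
    using IH1 low_degree_mono[of "length js" "Suc (length js)"] by (intro low_degree_add) auto
  then have "ladder js \<in> low_degree (Suc (length js))" by simp
  then have "ladder js \<in> low_degree (length (j # k # js))"
    using low_degree_mono[of "Suc (length js)" "length (j # k # js)"] by auto
  then have "y_minus j * y_plus k * ladder js \<in> low_degree (length (j # k # js))"
    using 3 by (intro polynomial_term_mult_low_degree y_minus_y_plus_edge) auto
  moreover have "x' j * (ladder (k # js) - (\<Prod>j\<leftarrow>k # js. x' j)) \<in> low_degree (length (j # k # js))"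
    using exchanged_mult_low_degree[OF IH2(2)] by simp
  ultimately have "x' j * (ladder (k # js) - (\<Prod>j\<leftarrow>k # js. x' j)) - y_minus j * y_plus k * ladder js
      \<in> low_degree (length (j # k # js))"
    by (intro low_degree_diff)
  moreover have "ladder (j # k # js) - (\<Prod>j\<leftarrow>j # k # js. x' j)
      = x' j * (ladder (k # js) - (\<Prod>j\<leftarrow>k # js. x' j)) - y_minus j * y_plus k * ladder js"
    unfolding ladder_recurrence by (simp add: right_diff_distrib)
  ultimately show ?case using exchanged_mult_low_degree[OF IH2(1), of j] by simp
qed

text \<open>
  If the walk closes up, the last index and the first are also joined by an edge.  The ladder
  along it then has small mixed words as well: they begin with a plus and end with a minus, the
  first and last factors together form a polynomial term, and the factors in between add up to a
  ladder shorter by two.  What remains are the two constant words, and these have no denominators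
  by \<open>closed_walk_products\<close>.  So the ladder, whose leading part is the product of the exchanged
  variables, has degree below the length of the walk, and hence so does that product.
\<close>

lemma closed_walk_reduction:
  assumes walk: "successively edge (a # js)" and "js \<noteq> []" and "last js = a"
  shows "(\<Prod>j\<leftarrow>js. x' j) \<in> low_degree (length js)"
proof -
  have js: "js = butlast js @ [a]" using assms by (metis append_butlast_last_id)
  (* A closed walk of length one would be a loop, so the list has distinct end positions. *)
  obtain k ks where k: "butlast js = k # ks"
  proof (cases "butlast js")
    case Nil
    then show ?thesis using js walk no_loops by (metis append_Nil less_irrefl successively.simps(3))
  qed
  define C where "C = k # ks @ [a]"
  have C: "js = C" using js k by (simp add: C_def)
  have walk': "successively edge C" "successively edge ks" "edge a k"
    using walk unfolding C C_def by (auto simp: successively_Cons successively_append_iff)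
  have *: "ladder C = y_minus a * y_plus k * ladder ks + (\<Prod>j\<leftarrow>C. y_plus j) + (\<Prod>j\<leftarrow>C. y_minus j)"
    using ladder_snoc[of "k # ks" a] by (simp add: C_def algebra_simps)
  have "ladder ks \<in> low_degree (length C)"
    using low_degree_add[of "ladder ks - (\<Prod>j\<leftarrow>ks. x' j)" "length C" "\<Prod>j\<leftarrow>ks. x' j"]
      ladder_leading_term[OF walk'(2)]
      low_degree_mono[of "length ks" "length C"] low_degree_mono[of "Suc (length ks)" "length C"]
    by (auto simp: C_def)
  then have "y_minus a * y_plus k * ladder ks \<in> low_degree (length C)"
    using walk' by (intro polynomial_term_mult_low_degree y_minus_y_plus_edge)
  moreover have "(\<Prod>j\<leftarrow>C. y_plus j) \<in> low_degree (length C)" "(\<Prod>j\<leftarrow>C. y_minus j) \<in> low_degree (length C)"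
    using closed_walk_products[OF assms] polynomial_term_low_degree
      low_degree_mono[of "Suc 0" "length C"] by (auto simp: C) (auto simp: C_def)
  ultimately have "ladder C \<in> low_degree (length C)"
    unfolding * by (intro low_degree_add)
  from low_degree_diff[OF this conjunct2[OF ladder_leading_term[OF walk'(1)]]]
  show ?thesis by (simp add: C)
qed

section \<open>Standard monomials span the lower bound\<close>

lemma exchange_product_val:
  "\<exists>r s \<alpha> \<beta>. x j * x' j = \<iota> r * val (\<alpha>, \<lambda>_. 0) + \<iota> s * val (\<beta>, \<lambda>_. 0)"
proof -
  have "x j * x' j = \<iota> (Poly_Mapping.single (p_plus \<Sigma> j) 1) * laurent (plus_exponent j) +
      \<iota> (Poly_Mapping.single (p_minus \<Sigma> j) 1) * laurent (minus_exponent j)"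
    by (simp add: exchanged_eq y_plus_def y_minus_def laurent_diff cluster_nonzero field_simps)
  moreover have "laurent (plus_exponent j) = val (\<lambda>i. nat (plus_exponent j $ i), \<lambda>_. 0)"
    and "laurent (minus_exponent j) = val (\<lambda>i. nat (minus_exponent j $ i), \<lambda>_. 0)"
    by (rule laurent_nonneg_val; simp add: plus_exponent_def minus_exponent_def)+
  ultimately show ?thesis by metis
qed

text \<open>
  The exchange relation replaces \<open>x j * x' j\<close> by a polynomial in the cluster alone.  Each use lowers
  the degree in the exchanged variables, so the rewriting ends, and it never raises that degree;
  the bound on the degree is what the dependence argument below needs.
\<close>

lemma straightening:
  "val (a, c) \<in> scalars.span (val ` {(a', c') \<in> standard_monomials. sum c' UNIV \<le> sum c UNIV})"
proof (induction "sum c UNIV" arbitrary: a c rule: less_induct)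
  case less
  show ?case
  proof (cases "(a, c) \<in> standard_monomials")
    case True
    then show ?thesis by (auto intro!: scalars.span_base imageI)
  next
    case False
    then obtain j where j: "a j > 0" "c j > 0" unfolding standard_monomials_def by auto
    define a' c' where "a' = a(j := a j - 1)" and "c' = c(j := c j - 1)"
    have "sum c UNIV = Suc (sum c' UNIV)"
      using j by (simp add: c'_def sum.remove[of UNIV j])
    then have low: "sum c' UNIV < sum c UNIV" by simp
    have IH: "val (d, c') \<in> scalars.span (val ` {(a', c') \<in> standard_monomials. sum c' UNIV \<le> sum c UNIV})"
      for d
      by (rule subsetD[OF scalars.span_mono less.hyps[OF low]]) (use low in auto)
    have "val (a, c) = val (a', c') * (x j * x' j)"
      unfolding cluster_val[of j] exchanged_val[of j] val_mult
      using j by (intro arg_cong[where f = val]) (auto simp: a'_def c'_def fun_eq_iff)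
    moreover obtain r s \<alpha> \<beta> where
      "x j * x' j = \<iota> r * val (\<alpha>, \<lambda>_. 0) + \<iota> s * val (\<beta>, \<lambda>_. 0)"
      using exchange_product_val by blast
    ultimately have "val (a, c) =
        \<iota> r * (val (a', c') * val (\<alpha>, \<lambda>_. 0)) + \<iota> s * (val (a', c') * val (\<beta>, \<lambda>_. 0))"
      by (simp add: algebra_simps)
    then show ?thesis
      using IH by (simp add: val_mult scalars.span_add scalars.span_scale)
  qed
qed

lemma span_standard_monomials_eq:
  "scalars.span (val ` standard_monomials) = scalars.span (range val)"
proof
  show "scalars.span (val ` standard_monomials) \<subseteq> scalars.span (range val)"
    by (rule scalars.span_mono) auto
  have "val m \<in> scalars.span (val ` standard_monomials)" for m
    using straightening[of "fst m" "snd m"]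
      scalars.span_mono[of "val ` {(a', c') \<in> standard_monomials. sum c' UNIV \<le> sum (snd m) UNIV}"
        "val ` standard_monomials"] by auto
  then show "scalars.span (range val) \<subseteq> scalars.span (val ` standard_monomials)"
    by (intro scalars.span_minimal) auto
qed

text \<open>
  By straightening, standard monomials span the same module as all monomials, and the latter is
  closed under products because monomials are.
\<close>

lemma standard_monomials_span_lower_bound:
  "scalars.span (val ` standard_monomials) = lower_bound \<iota> \<Sigma>"
  unfolding span_standard_monomials_eq
proof
  show "scalars.span (range val) \<subseteq> lower_bound \<iota> \<Sigma>"
    unfolding lower_bound_def hull_def
  proof (rule Inter_greatest)
    fix S assume "S \<in> {t. is_subalgebra \<iota> t \<and> range x \<union> range x' \<subseteq> t}"
    then have S: "\<And>r. \<iota> r \<in> S" "\<And>f g. f \<in> S \<Longrightarrow> g \<in> S \<Longrightarrow> f + g \<in> S"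
        "\<And>f g. f \<in> S \<Longrightarrow> g \<in> S \<Longrightarrow> f * g \<in> S" "\<And>j. x j \<in> S" "\<And>j. x' j \<in> S"
      unfolding is_subalgebra_def by auto
    have one: "1 \<in> S" using S(1)[of 1] by (simp add: embed_one)
    have power: "f ^ k \<in> S" if "f \<in> S" for f k
      using that by (induction k) (auto simp: one S)
    have prod: "prod f J \<in> S" if "\<And>j. f j \<in> S" for f :: "'n \<Rightarrow> 'f" and J
      using that by (induction J rule: infinite_finite_induct) (auto simp: one S)
    have "val m \<in> S" for m
      unfolding monomial_value_def by (cases m) (simp add: S power prod)
    moreover have "scalars.subspace S"
      using S(1)[of 0] by (auto simp: scalars.subspace_def embed_zero intro: S)
    ultimately show "scalars.span (range val) \<subseteq> S"
      by (intro scalars.span_minimal) auto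
  qed
  have val_0: "val (\<lambda>_. 0, \<lambda>_. 0) = 1" by (simp add: monomial_value_def)
  have base: "val m \<in> scalars.span (range val)" for m by (rule scalars.span_base) simp
  have mult: "f * g \<in> scalars.span (range val)"
    if "f \<in> scalars.span (range val)" "g \<in> scalars.span (range val)" for f g
    using _ that(2)
  proof (rule mult_span_closed)
    fix s assume "s \<in> range val"
    have "s * t \<in> scalars.span (range val)" if "t \<in> range val" for t
      using that \<open>s \<in> range val\<close> by (auto simp only: val_mult base split_paired_all)
    then have "s * f \<in> scalars.span (range val)"
      using that(1) by (rule mult_span_closed)
    then show "f * s \<in> scalars.span (range val)" by (simp add: mult.commute)
  qed
  have "is_subalgebra \<iota> (scalars.span (range val))"
    unfolding is_subalgebra_def
    using scalars.span_scale[OF base[of "(\<lambda>_. 0, \<lambda>_. 0)"]] mult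
    by (auto simp: val_0 scalars.span_add)
  then show "lower_bound \<iota> \<Sigma> \<subseteq> scalars.span (range val)"
    unfolding lower_bound_def
    by (rule hull_minimal[rotated]) (auto simp: cluster_val exchanged_val base)
qed

section \<open>Oriented cycles make the standard monomials dependent\<close>

lemma prod_exchanged_val: "(\<Prod>j\<leftarrow>js. x' j) = val (\<lambda>_. 0, count_list js)"
proof (induction js)
  case Nil
  then show ?case by (simp add: monomial_value_def)
next
  case (Cons j js)
  then show ?case
    by (simp add: exchanged_val[of j] val_mult) (auto intro!: arg_cong[where f = val])
qed

text \<open>
  The product of the exchanged variables along a closed walk is itself a standard monomial, since
  it involves no cluster variable; indices may repeat.  By the reduction above and straightening it
  is a combination of standard monomials of strictly smaller degree.
\<close>

theorem independent_imp_acyclic: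
  assumes "standard_monomials_independent \<iota> \<Sigma>"
  shows "acyclic_seed \<Sigma>"
proof (rule ccontr)
  assume "\<not> acyclic_seed \<Sigma>"
  then obtain a js where walk: "js \<noteq> []" "last js = a" "successively edge (a # js)"
    unfolding acyclic_seed_def acyclic_def using walk_of_trancl by metis
  let ?m = "(\<lambda>_. 0, count_list js)"
  have m: "?m \<in> standard_monomials" by (simp add: standard_monomials_def)
  let ?T = "{(a, c) \<in> standard_monomials. sum c UNIV < length js}"
  have "val ?m \<in> low_degree (length js)"
    using closed_walk_reduction[OF walk(3,1,2)] by (simp add: prod_exchanged_val)
  moreover have "low_degree (length js) \<subseteq> scalars.span (val ` ?T)"
    unfolding low_degree_def
  proof (intro scalars.span_minimal subsetI)
    fix v assume "v \<in> val ` {(a, c). sum c UNIV < length js}"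
    then obtain d c where v: "v = val (d, c)" and c: "sum c UNIV < length js" by auto
    show "v \<in> scalars.span (val ` ?T)"
      unfolding v by (rule subsetD[OF scalars.span_mono straightening]) (use c in auto)
  qed (rule scalars.subspace_span)
  moreover have "val ` ?T \<subseteq> val ` standard_monomials - {val ?m}"
  proof -
    have "?m \<notin> ?T" using sum_count_list_UNIV[of js] by simp
    moreover have "?T \<subseteq> standard_monomials" by blast
    moreover have "inj_on val standard_monomials"
      using assms unfolding standard_monomials_independent_def by blast
    ultimately have "val ?m \<notin> val ` ?T" and "val ` ?T \<subseteq> val ` standard_monomials"
      using inj_on_image_mem_iff[OF _ m, of val ?T] by (blast, intro image_mono)
    then show ?thesis by (simp only: subset_Diff_insert Diff_empty simp_thms)
  qed
  then have "scalars.span (val ` ?T) \<subseteq> scalars.span (val ` standard_monomials - {val ?m})"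
    by (rule scalars.span_mono)
  ultimately have "val ?m \<in> scalars.span (val ` standard_monomials - {val ?m})" by blast
  then obtain t u where t: "finite t" "t \<subseteq> val ` standard_monomials - {val ?m}"
    and u: "val ?m = (\<Sum>v\<in>t. \<iota> (u v) * v)"
    unfolding scalars.span_explicit by blast
  (* Move the value of the monomial to the other side to exhibit a relation with a unit coefficient. *)
  let ?u = "u(val ?m := - 1)"
  have "(\<Sum>v\<in>insert (val ?m) t. \<iota> (?u v) * v) = \<iota> (- 1) * val ?m + (\<Sum>v\<in>t. \<iota> (?u v) * v)"
    using t by (subst sum.insert) auto
  also have "(\<Sum>v\<in>t. \<iota> (?u v) * v) = (\<Sum>v\<in>t. \<iota> (u v) * v)"
    using t by (intro sum.cong) auto
  also have "\<dots> = val ?m" by (rule u[symmetric])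
  finally have "(\<Sum>v\<in>insert (val ?m) t. \<iota> (?u v) * v) = 0"
    by (simp add: embed_uminus embed_one)
  then have "scalars.dependent (val ` standard_monomials)"
    unfolding scalars.dependent_explicit using t m
    by (intro exI[of _ "insert (val ?m) t"] exI[of _ ?u]) auto
  then show False using assms unfolding standard_monomials_independent_def by blast
qed

section \<open>Laurent polynomials in the cluster\<close>

text \<open>
  Laurent polynomials over the group ring, modelled as finitely supported functions of the exponent
  vector so that multiplication is convolution.  Evaluation at the cluster is an injective ring
  homomorphism, which lets leading terms be read off formally.
\<close>

definition laurent_eval :: "(int ^ 'n \<Rightarrow>\<^sub>0 'p group_ring) \<Rightarrow> 'f" where
  "laurent_eval p = (\<Sum>\<alpha>\<in>Poly_Mapping.keys p. \<iota> (Poly_Mapping.lookup p \<alpha>) * laurent \<alpha>)"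

lemma laurent_eval_superset:
  assumes "finite S" and "Poly_Mapping.keys p \<subseteq> S"
  shows "laurent_eval p = (\<Sum>\<alpha>\<in>S. \<iota> (Poly_Mapping.lookup p \<alpha>) * laurent \<alpha>)"
  unfolding laurent_eval_def using assms
  by (intro sum.mono_neutral_left) (auto simp: in_keys_iff embed_zero)

lemma laurent_eval_add: "laurent_eval (p + q) = laurent_eval p + laurent_eval q"
proof -
  let ?S = "Poly_Mapping.keys p \<union> Poly_Mapping.keys q"
  have "laurent_eval p = (\<Sum>\<alpha>\<in>?S. \<iota> (Poly_Mapping.lookup p \<alpha>) * laurent \<alpha>)"
    and "laurent_eval q = (\<Sum>\<alpha>\<in>?S. \<iota> (Poly_Mapping.lookup q \<alpha>) * laurent \<alpha>)"
    and "laurent_eval (p + q) = (\<Sum>\<alpha>\<in>?S. \<iota> (Poly_Mapping.lookup (p + q) \<alpha>) * laurent \<alpha>)"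
    using Poly_Mapping.keys_add[of p q] by (intro laurent_eval_superset; simp)+
  then show ?thesis by (simp add: lookup_add embed_add distrib_right sum.distrib)
qed

lemma laurent_eval_sum: "laurent_eval (\<Sum>i\<in>I. f i) = (\<Sum>i\<in>I. laurent_eval (f i))"
proof -
  have "laurent_eval 0 = 0" by (simp add: laurent_eval_def)
  then show ?thesis
    by (induction I rule: infinite_finite_induct) (simp_all add: laurent_eval_add)
qed

lemma laurent_eval_single: "laurent_eval (Poly_Mapping.single \<alpha> r) = \<iota> r * laurent \<alpha>"
  by (subst laurent_eval_superset[of "{\<alpha>}"]) auto

lemma laurent_eval_mult: "laurent_eval (p * q) = laurent_eval p * laurent_eval q"
proof -
  have "laurent_eval (p * q) = (\<Sum>(\<alpha>, \<beta>)\<in>Poly_Mapping.keys p \<times> Poly_Mapping.keys q.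
      (\<iota> (Poly_Mapping.lookup p \<alpha>) * laurent \<alpha>) * (\<iota> (Poly_Mapping.lookup q \<beta>) * laurent \<beta>))"
    unfolding mult_eq_sum_singles[of p q] laurent_eval_sum
    by (intro sum.cong) (auto simp: laurent_eval_single embed_mult laurent_add)
  then show ?thesis by (simp add: laurent_eval_def sum_product sum.cartesian_product)
qed

lemma laurent_eval_1: "laurent_eval 1 = 1"
  using laurent_eval_single[of 0 1] by (simp add: embed_one)

lemma laurent_eval_power: "laurent_eval (p ^ k) = laurent_eval p ^ k"
  by (induction k) (simp_all add: laurent_eval_1 laurent_eval_mult)

lemma laurent_eval_prod: "laurent_eval (\<Prod>i\<in>I. f i) = (\<Prod>i\<in>I. laurent_eval (f i))"
  by (induction I rule: infinite_finite_induct) (simp_all add: laurent_eval_1 laurent_eval_mult)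

text \<open>
  Multiplying by a large power of all cluster variables clears denominators and turns a Laurent
  relation into a polynomial one, which algebraic independence excludes.
\<close>

lemma laurent_eval_eq_0:
  assumes "laurent_eval p = 0"
  shows "p = 0"
proof -
  let ?K = "Poly_Mapping.keys p"
  define N :: int where "N = (\<Sum>\<alpha>\<in>?K. \<Sum>i\<in>UNIV. \<bar>\<alpha> $ i\<bar>)"
  have N: "0 \<le> \<alpha> $ i + N" if "\<alpha> \<in> ?K" for \<alpha> i
  proof -
    have "\<bar>\<alpha> $ i\<bar> \<le> (\<Sum>i\<in>UNIV. \<bar>\<alpha> $ i\<bar>)" by (rule member_le_sum) auto
    also have "\<dots> \<le> N"
      unfolding N_def using that
      by (intro member_le_sum[of \<alpha> ?K "\<lambda>\<alpha>. \<Sum>i\<in>UNIV. \<bar>\<alpha> $ i\<bar>"]) (auto intro: sum_nonneg)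
    finally show ?thesis by linarith
  qed
  (* The Laurent exponent h m is the exponent m shifted down by N in every component. *)
  define h :: "('n \<Rightarrow>\<^sub>0 nat) \<Rightarrow> int ^ 'n" where
    "h m = (\<chi> i. int (Poly_Mapping.lookup m i) - N)" for m
  have inj: "inj h"
    by (rule injI) (auto simp: h_def vec_eq_iff intro: poly_mapping_eqI)
  have range: "?K \<subseteq> range h"
  proof
    fix \<alpha> assume "\<alpha> \<in> ?K"
    then have "\<alpha> = h (Abs_poly_mapping (\<lambda>i. nat (\<alpha> $ i + N)))"
      using N by (auto simp: h_def vec_eq_iff)
    then show "\<alpha> \<in> range h" by blast
  qed
  define q where "q = Abs_poly_mapping (\<lambda>m. \<iota> (Poly_Mapping.lookup p (h m)))"
  have support: "{m. \<iota> (Poly_Mapping.lookup p (h m)) \<noteq> 0} = h -` ?K"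
    by (auto simp: embed_eq_0_iff in_keys_iff)
  then have "finite {m. \<iota> (Poly_Mapping.lookup p (h m)) \<noteq> 0}"
    using inj by (simp add: finite_vimageI)
  then have lookup_q: "Poly_Mapping.lookup q = (\<lambda>m. \<iota> (Poly_Mapping.lookup p (h m)))"
    unfolding q_def by (rule lookup_Abs_poly_mapping)
  then have keys_q: "Poly_Mapping.keys q = h -` ?K"
    using support by (simp add: Poly_Mapping.keys.rep_eq)
  have monomial: "(\<Prod>i\<in>UNIV. x i ^ Poly_Mapping.lookup m i) = laurent (h m) * laurent (\<chi> i. N)" for m
  proof -
    have "h m + (\<chi> i. N) = (\<chi> i. int (Poly_Mapping.lookup m i))"
      by (simp add: h_def vec_eq_iff)
    then show ?thesis by (simp add: laurent_nonneg flip: laurent_add)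
  qed
  have "poly_eval x q =
      (\<Sum>m\<in>h -` ?K. \<iota> (Poly_Mapping.lookup p (h m)) * laurent (h m)) * laurent (\<chi> i. N)"
    by (simp add: poly_eval_def keys_q lookup_q monomial sum_distrib_right mult.assoc)
  also have "(\<Sum>m\<in>h -` ?K. \<iota> (Poly_Mapping.lookup p (h m)) * laurent (h m)) =
      (\<Sum>\<alpha>\<in>h ` (h -` ?K). \<iota> (Poly_Mapping.lookup p \<alpha>) * laurent \<alpha>)"
    by (subst sum.reindex) (auto intro: inj_on_subset[OF inj])
  also have "h ` (h -` ?K) = ?K" using range by (simp add: image_vimage_eq Int_absorb2)
  also have "(\<Sum>\<alpha>\<in>?K. \<iota> (Poly_Mapping.lookup p \<alpha>) * laurent \<alpha>) = 0"
    using assms unfolding laurent_eval_def .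
  finally have "poly_eval x q = 0" by simp
  moreover have "range (Poly_Mapping.lookup q) \<subseteq> fraction_field \<iota>"
    unfolding lookup_q using embed_in_fraction_field by blast
  ultimately have "q = 0" using cluster_independent unfolding algebraically_independent_def by blast
  then have "h -` ?K = {}" using keys_q by simp
  then have "?K = {}" using range by blast
  then show ?thesis by (intro poly_mapping_eqI) (metis empty_iff in_keys_iff lookup_zero)
qed

section \<open>Leading terms for an acyclic seed\<close>

abbreviation precedes :: "'n \<Rightarrow> 'n \<Rightarrow> bool" where
  "precedes i k \<equiv> (i, k) \<in> {(i, j). edge i j}\<^sup>+"

text \<open>
  A lexicographic comparison along the graph: \<open>\<beta>\<close> is at least as large as \<open>\<alpha>\<close> at each index up to
  which (strictly before it) the two agree.  Working with the graph's own order in place of a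
  linear extension of it gives only a partial order, but a minimal element of a finite set is all
  that is used later.
\<close>

definition below :: "int ^ 'n \<Rightarrow> int ^ 'n \<Rightarrow> bool" where
  "below \<alpha> \<beta> \<longleftrightarrow> (\<forall>k. (\<forall>i. precedes i k \<longrightarrow> \<alpha> $ i = \<beta> $ i) \<longrightarrow> \<alpha> $ k \<le> \<beta> $ k)"

definition leading :: "(int ^ 'n \<Rightarrow>\<^sub>0 'p group_ring) \<Rightarrow> int ^ 'n \<Rightarrow> bool" where
  "leading p \<alpha> \<longleftrightarrow> Poly_Mapping.lookup p \<alpha> \<noteq> 0 \<and> (\<forall>\<beta>\<in>Poly_Mapping.keys p. below \<alpha> \<beta>)"

text \<open>
  If \<open>j\<close> is a source, \<open>y_plus j\<close> has the exponent \<open>- axis j 1\<close> and is the smaller term; otherwise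
  \<open>y_minus j\<close> is, because \<open>y_plus j\<close> has a positive exponent at some predecessor of \<open>j\<close>.  In both cases
  the leading exponent is \<open>-1\<close> at \<open>j\<close> and vanishes at the other indices that do not come after \<open>j\<close>.
\<close>

definition leading_exponent :: "'n \<Rightarrow> int ^ 'n" where
  "leading_exponent j = (if plus_exponent j = 0 then plus_exponent j else minus_exponent j) - axis j 1"

definition exchange_laurent :: "'n \<Rightarrow> int ^ 'n \<Rightarrow>\<^sub>0 'p group_ring" where
  "exchange_laurent j =
     Poly_Mapping.single (plus_exponent j - axis j 1) (Poly_Mapping.single (p_plus \<Sigma> j) 1) +
     Poly_Mapping.single (minus_exponent j - axis j 1) (Poly_Mapping.single (p_minus \<Sigma> j) 1)"

text \<open>
  The formal counterpart of \<open>monomial_value\<close>; its leading exponent is \<open>monomial_exponent\<close>.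
\<close>

definition monomial_laurent :: "('n \<Rightarrow> nat) \<times> ('n \<Rightarrow> nat) \<Rightarrow> int ^ 'n \<Rightarrow>\<^sub>0 'p group_ring" where
  "monomial_laurent m = (\<Prod>j\<in>UNIV. Poly_Mapping.single (axis j 1) 1 ^ fst m j * exchange_laurent j ^ snd m j)"

definition monomial_exponent :: "('n \<Rightarrow> nat) \<times> ('n \<Rightarrow> nat) \<Rightarrow> int ^ 'n" where
  "monomial_exponent m = (\<Sum>j\<in>UNIV. int (fst m j) *s axis j 1 + int (snd m j) *s leading_exponent j)"

lemma laurent_eval_monomial_laurent: "laurent_eval (monomial_laurent m) = val m"
  by (cases m)
    (simp add: monomial_laurent_def monomial_value_def laurent_eval_prod laurent_eval_mult
      laurent_eval_power laurent_eval_single embed_one exchange_laurent_def laurent_eval_add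
      exchanged_eq y_plus_def y_minus_def)

lemma below_refl: "below \<alpha> \<alpha>"
  by (simp add: below_def)

lemma below_pointwise: "(\<And>k. \<alpha> $ k \<le> \<beta> $ k) \<Longrightarrow> below \<alpha> \<beta>"
  by (simp add: below_def)

lemma below_add_right: "below \<alpha> \<beta> \<Longrightarrow> below (\<alpha> + \<gamma>) (\<beta> + \<gamma>)"
  by (simp add: below_def)

lemma below_add_left: "below \<alpha> \<beta> \<Longrightarrow> below (\<gamma> + \<alpha>) (\<gamma> + \<beta>)"
  by (simp add: below_def)

context
  assumes acyclic: "acyclic_seed \<Sigma>"
begin

lemma wf_precedes: "wf ({(i, j). edge i j}\<^sup>+)"
  using acyclic finite_acyclic_wf[of "{(i, j). edge i j}"] by (simp add: acyclic_seed_def wf_trancl)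

text \<open>
  Going along the graph, the two exponent vectors are forced to agree index by index.
\<close>

lemma below_antisym:
  assumes "below \<alpha> \<beta>" and "below \<beta> \<alpha>"
  shows "\<alpha> = \<beta>"
proof -
  have "\<alpha> $ k = \<beta> $ k" for k
    using wf_precedes
  proof (induction k rule: wf_induct_rule)
    case (less k)
    then show ?case using assms unfolding below_def by (metis order_antisym)
  qed
  then show ?thesis by (simp add: vec_eq_iff)
qed

text \<open>
  If \<open>\<alpha>\<close> and \<open>\<gamma>\<close> agree at all predecessors of \<open>k\<close>, then \<open>\<beta>\<close> is squeezed between them there, again
  by induction along the graph.
\<close>

lemma below_trans:
  assumes "below \<alpha> \<beta>" and "below \<beta> \<gamma>"
  shows "below \<alpha> \<gamma>"
  unfolding below_def
proof (intro allI impI)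
  fix k assume eq: "\<forall>i. precedes i k \<longrightarrow> \<alpha> $ i = \<gamma> $ i"
  have *: "precedes i k \<longrightarrow> \<alpha> $ i = \<beta> $ i" for i
    using wf_precedes
  proof (induction i rule: wf_induct_rule)
    case (less i)
    show ?case
    proof
      assume "precedes i k"
      then have before: "precedes j k" if "precedes j i" for j using that by (rule trancl_trans[rotated])
      have "\<alpha> $ i \<le> \<beta> $ i" using assms(1) less before unfolding below_def by blast
      moreover have "\<beta> $ j = \<gamma> $ j" if "precedes j i" for j
        using less that before eq by metis
      then have "\<beta> $ i \<le> \<gamma> $ i" using assms(2) unfolding below_def by blast
      ultimately show "\<alpha> $ i = \<beta> $ i" using eq \<open>precedes i k\<close> by force
    qed
  qed
  then have "\<alpha> $ k \<le> \<beta> $ k" using assms(1) unfolding below_def by blast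
  also have "\<beta> $ k \<le> \<gamma> $ k" using assms(2) * eq unfolding below_def by metis
  finally show "\<alpha> $ k \<le> \<gamma> $ k" .
qed

lemma below_add_mono: "below \<alpha> \<gamma> \<Longrightarrow> below \<beta> \<delta> \<Longrightarrow> below (\<alpha> + \<beta>) (\<gamma> + \<delta>)"
  using below_trans below_add_left below_add_right by metis

lemma below_add_eq:
  assumes "below \<alpha> \<gamma>" and "below \<beta> \<delta>" and "\<gamma> + \<delta> = \<alpha> + \<beta>"
  shows "\<gamma> = \<alpha> \<and> \<delta> = \<beta>"
proof -
  have "below (\<gamma> + \<beta>) (\<alpha> + \<beta>)" using below_add_left[OF assms(2), of \<gamma>] assms(3) by simp
  then have "\<alpha> + \<beta> = \<gamma> + \<beta>" by (rule below_antisym[OF below_add_right[OF assms(1)]])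
  then show ?thesis using assms(3) by simp
qed

text \<open>
  The sum of the leading exponents arises in only one way as a sum of exponents of the factors, so
  its coefficient is the product of the leading coefficients.
\<close>

lemma leading_mult:
  assumes "leading p \<alpha>" and "leading q \<beta>"
  shows "leading (p * q) (\<alpha> + \<beta>)"
proof -
  let ?K = "Poly_Mapping.keys p \<times> Poly_Mapping.keys q"
  let ?c = "\<lambda>(\<gamma>, \<delta>). Poly_Mapping.lookup p \<gamma> * Poly_Mapping.lookup q \<delta> when \<gamma> + \<delta> = \<alpha> + \<beta>"
  have "Poly_Mapping.lookup (p * q) (\<alpha> + \<beta>) = (\<Sum>m\<in>?K. ?c m)"
    unfolding mult_eq_sum_singles lookup_sum
    by (intro sum.cong) (auto simp: lookup_single)
  also have "\<dots> = (\<Sum>m\<in>{(\<alpha>, \<beta>)}. ?c m)"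
  proof (rule sum.mono_neutral_right)
    show "{(\<alpha>, \<beta>)} \<subseteq> ?K" using assms by (auto simp: leading_def in_keys_iff)
    show "\<forall>m\<in>?K - {(\<alpha>, \<beta>)}. ?c m = 0"
    proof
      fix m assume "m \<in> ?K - {(\<alpha>, \<beta>)}"
      then obtain \<gamma> \<delta> where m: "m = (\<gamma>, \<delta>)" "below \<alpha> \<gamma>" "below \<beta> \<delta>" "(\<gamma>, \<delta>) \<noteq> (\<alpha>, \<beta>)"
        using assms by (auto simp: leading_def)
      then have "\<gamma> + \<delta> \<noteq> \<alpha> + \<beta>" using below_add_eq by blast
      then show "?c m = 0" by (simp add: m(1))
    qed
  qed simp
  also have "\<dots> \<noteq> 0"
    using assms group_ring_mult_eq_0 by (auto simp: leading_def)
  finally have "Poly_Mapping.lookup (p * q) (\<alpha> + \<beta>) \<noteq> 0" .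
  moreover have "below (\<alpha> + \<beta>) \<epsilon>" if "\<epsilon> \<in> Poly_Mapping.keys (p * q)" for \<epsilon>
    using keys_mult[of p q] that assms below_add_mono unfolding leading_def by blast
  ultimately show ?thesis by (simp add: leading_def)
qed

lemma leading_single: "r \<noteq> 0 \<Longrightarrow> leading (Poly_Mapping.single \<alpha> r) \<alpha>"
  by (simp add: leading_def below_refl)

lemma leading_1: "leading 1 0"
  using leading_single[of 1 0] by simp

lemma leading_power: "leading p \<alpha> \<Longrightarrow> leading (p ^ k) (int k *s \<alpha>)"
proof (induction k)
  case 0
  then show ?case by (simp add: leading_1)
next
  case (Suc k)
  moreover have "int (Suc k) *s \<alpha> = \<alpha> + int k *s \<alpha>" by (simp add: vec_eq_iff algebra_simps)
  ultimately show ?case using leading_mult by simp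
qed

lemma leading_prod: "(\<And>i. leading (f i) (g i)) \<Longrightarrow> leading (\<Prod>i\<in>I. f i) (\<Sum>i\<in>I. g i)"
  by (induction I rule: infinite_finite_induct) (simp_all add: leading_1 leading_mult)

text \<open>
  The two exponents may coincide (this happens at isolated vertices); the coefficients then add up
  to \<open>g + h\<close> in the group ring, which is nonzero because no cancellation occurs between
  positive coefficients.
\<close>

lemma leading_two_terms:
  assumes "below \<alpha> \<beta>"
  shows "leading (Poly_Mapping.single \<alpha> (Poly_Mapping.single g 1)
      + Poly_Mapping.single \<beta> (Poly_Mapping.single h 1)) \<alpha>"
proof -
  have "Poly_Mapping.single g 1 + Poly_Mapping.single h (1::int) \<noteq> 0"
  proof
    assume "Poly_Mapping.single g 1 + Poly_Mapping.single h (1::int) = 0"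
    then have "Poly_Mapping.lookup (Poly_Mapping.single g 1 + Poly_Mapping.single h (1::int)) g = 0"
      by simp
    then show False by (simp add: lookup_add lookup_single when_def split: if_splits)
  qed
  then show ?thesis
    using assms Poly_Mapping.keys_add[of "Poly_Mapping.single \<alpha> (Poly_Mapping.single g (1::int))"
        "Poly_Mapping.single \<beta> (Poly_Mapping.single h 1)"]
    by (auto simp: leading_def lookup_add lookup_single when_def single_eq_0_iff below_refl
        split: if_splits)
qed

text \<open>
  If \<open>j\<close> has a predecessor \<open>i\<close>, the two exponents differ at \<open>i\<close>, which precedes every successor of
  \<open>j\<close>.  So the successors, where the minus exponent is the larger one, are never reached by the
  comparison.
\<close>

lemma leading_exchange_laurent: "leading (exchange_laurent j) (leading_exponent j)"
proof (cases "plus_exponent j = 0")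
  case True
  have "below (plus_exponent j - axis j 1) (minus_exponent j - axis j 1)"
    by (rule below_pointwise) (simp add: True minus_exponent_def)
  then show ?thesis
    unfolding exchange_laurent_def leading_exponent_def if_P[OF True] by (rule leading_two_terms)
next
  case False
  then obtain i where i: "edge i j"
    by (auto simp: plus_exponent_def vec_eq_iff max_def not_le split: if_splits)
  have "below (minus_exponent j - axis j 1) (plus_exponent j - axis j 1)"
    unfolding below_def
  proof (intro allI impI)
    fix k assume eq: "\<forall>i. precedes i k \<longrightarrow>
        (minus_exponent j - axis j 1) $ i = (plus_exponent j - axis j 1) $ i"
    have "\<not> edge j k"
    proof
      assume "edge j k"
      then have "precedes i k" using i by (intro trancl_into_trancl[OF r_into_trancl, where b = j]) auto
      then show False using eq i by (auto simp: plus_exponent_def minus_exponent_def)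
    qed
    then have "minus_exponent j $ k = 0"
      using neg_entry_iff[of k j] by (auto simp: minus_exponent_def)
    then show "(minus_exponent j - axis j 1) $ k \<le> (plus_exponent j - axis j 1) $ k"
      by (simp add: plus_exponent_def)
  qed
  then show ?thesis
    unfolding exchange_laurent_def leading_exponent_def if_not_P[OF False]
    by (subst add.commute) (rule leading_two_terms)
qed

lemma leading_monomial_laurent: "leading (monomial_laurent m) (monomial_exponent m)"
  unfolding monomial_laurent_def monomial_exponent_def
  by (intro leading_prod leading_mult leading_power leading_exchange_laurent leading_single) simp

lemma leading_exponent_self: "leading_exponent j $ j = - 1"
  using no_loops[of j] by (simp add: leading_exponent_def minus_exponent_def axis_def)

lemma leading_exponent_other:
  assumes "k \<noteq> j" and "\<not> precedes j k"
  shows "leading_exponent j $ k = 0"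
  using assms neg_entry_iff[of k j]
  by (auto simp: leading_exponent_def minus_exponent_def axis_def max_def)

lemma monomial_exponent_component:
  "monomial_exponent (a, c) $ k =
     int (a k) - int (c k) + (\<Sum>j | precedes j k. int (c j) * leading_exponent j $ k)"
proof -
  have irrefl: "\<not> precedes k k" using acyclic by (simp add: acyclic_seed_def acyclic_def)
  have "(\<Sum>j\<in>UNIV. int (a j) * axis j 1 $ k) = int (a k)"
    by (simp add: axis_def if_distrib sum.delta cong: if_cong)
  moreover have "(\<Sum>j\<in>UNIV. int (c j) * leading_exponent j $ k) =
      - int (c k) + (\<Sum>j\<in>UNIV - {k}. int (c j) * leading_exponent j $ k)"
    by (simp add: sum.remove[of UNIV k] leading_exponent_self)
  moreover have "(\<Sum>j\<in>UNIV - {k}. int (c j) * leading_exponent j $ k) =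
      (\<Sum>j | precedes j k. int (c j) * leading_exponent j $ k)"
    using irrefl leading_exponent_other by (intro sum.mono_neutral_right) auto
  ultimately show ?thesis by (simp add: monomial_exponent_def sum.distrib)
qed

text \<open>
  The map is triangular along the graph: once the exponents at all predecessors of \<open>k\<close> are known, the
  component at \<open>k\<close> gives the difference \<open>a k - c k\<close>, and for a standard monomial, where one of the two
  vanishes, this determines both.
\<close>

lemma inj_on_monomial_exponent: "inj_on monomial_exponent standard_monomials"
proof (rule inj_onI)
  fix m m' assume std: "m \<in> standard_monomials" "m' \<in> standard_monomials"
    and eq: "monomial_exponent m = monomial_exponent m'"
  obtain a c a' c' where m: "m = (a, c)" "m' = (a', c')" by (cases m, cases m')
  have "a k = a' k \<and> c k = c' k" for k
    using wf_precedes
  proof (induction k rule: wf_induct_rule)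
    case (less k)
    then have "(\<Sum>j | precedes j k. int (c j) * leading_exponent j $ k) =
        (\<Sum>j | precedes j k. int (c' j) * leading_exponent j $ k)"
      by (intro sum.cong) auto
    then have "int (a k) - int (c k) = int (a' k) - int (c' k)"
      using eq monomial_exponent_component[of a c k] monomial_exponent_component[of a' c' k]
      unfolding m by simp
    moreover have "\<not> (a k > 0 \<and> c k > 0)" "\<not> (a' k > 0 \<and> c' k > 0)"
      using std unfolding m standard_monomials_def by auto
    ultimately show ?case by linarith
  qed
  then show "m = m'" unfolding m by auto
qed

text \<open>
  Among the monomials with nonzero coefficient pick one whose leading exponent is minimal.  Its
  leading exponent occurs in no other of these monomials, so it survives in the sum.
\<close>

lemma linear_relation_trivial:
  assumes "finite T" and "T \<subseteq> standard_monomials"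
    and relation: "(\<Sum>m\<in>T. \<iota> (u m) * val m) = 0" and "n \<in> T"
  shows "u n = 0"
proof (rule ccontr)
  assume "u n \<noteq> 0"
  define T' where "T' = {m \<in> T. u m \<noteq> 0}"
  define strictly_below where
    "strictly_below m m' \<longleftrightarrow> below (monomial_exponent m) (monomial_exponent m') \<and>
       monomial_exponent m \<noteq> monomial_exponent m'" for m m'
  have "finite T'" using assms by (simp add: T'_def)
  moreover have "n \<in> T'" using assms \<open>u n \<noteq> 0\<close> by (simp add: T'_def)
  then have "T' \<noteq> {}" by blast
  moreover have "asymp_on T' strictly_below"
    by (rule asymp_onI) (auto simp: strictly_below_def dest: below_antisym)
  moreover have "transp_on T' strictly_below"
    by (rule transp_onI) (auto simp: strictly_below_def dest: below_antisym intro: below_trans)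
  ultimately obtain m where m: "m \<in> T'" "\<forall>m'\<in>T'. m' \<noteq> m \<longrightarrow> \<not> strictly_below m' m"
    using Finite_Set.bex_min_element[of T' strictly_below] by blast
  have lookup_scale: "Poly_Mapping.lookup (Poly_Mapping.single 0 r * p) \<alpha> = r * Poly_Mapping.lookup p \<alpha>"
    for r :: "'p group_ring" and p :: "int ^ 'n \<Rightarrow>\<^sub>0 'p group_ring" and \<alpha>
    unfolding mult_map_scale_conv_mult[symmetric] by (simp add: Poly_Mapping.map.rep_eq when_def)
  let ?p = "\<Sum>m\<in>T'. Poly_Mapping.single 0 (u m) * monomial_laurent m"
  have "laurent_eval ?p = (\<Sum>m\<in>T'. \<iota> (u m) * val m)"
    by (simp add: laurent_eval_sum laurent_eval_mult laurent_eval_single laurent_eval_monomial_laurent)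
  also have "\<dots> = (\<Sum>m\<in>T. \<iota> (u m) * val m)"
    using \<open>finite T\<close> by (intro sum.mono_neutral_left) (auto simp: T'_def embed_zero)
  finally have "?p = 0" using relation laurent_eval_eq_0 by simp
  then have "0 = Poly_Mapping.lookup ?p (monomial_exponent m)" by simp
  also have "\<dots> = (\<Sum>m'\<in>T'. u m' * Poly_Mapping.lookup (monomial_laurent m') (monomial_exponent m))"
    by (simp add: lookup_sum lookup_scale)
  also have "\<dots> = u m * Poly_Mapping.lookup (monomial_laurent m) (monomial_exponent m)"
  proof -
    have "Poly_Mapping.lookup (monomial_laurent m') (monomial_exponent m) = 0"
      if "m' \<in> T' - {m}" for m'
    proof (rule ccontr)
      assume "Poly_Mapping.lookup (monomial_laurent m') (monomial_exponent m) \<noteq> 0"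
      then have "below (monomial_exponent m') (monomial_exponent m)"
        using leading_monomial_laurent[of m'] unfolding leading_def by (auto simp: in_keys_iff)
      moreover have "monomial_exponent m' \<noteq> monomial_exponent m"
        using inj_on_monomial_exponent that m(1) assms(2) by (auto simp: T'_def dest!: inj_onD)
      ultimately show False using m(2) that by (auto simp: strictly_below_def)
    qed
    then show ?thesis using \<open>finite T'\<close> m(1) by (simp add: sum.remove[of T' m])
  qed
  finally have "u m * Poly_Mapping.lookup (monomial_laurent m) (monomial_exponent m) = 0" by simp
  then show False
    using group_ring_mult_eq_0 m(1) leading_monomial_laurent[of m] by (auto simp: leading_def T'_def)
qed

theorem acyclic_imp_independent: "standard_monomials_independent \<iota> \<Sigma>"
  unfolding standard_monomials_independent_def
proof
  show inj: "inj_on val standard_monomials"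
  proof (rule inj_onI, rule ccontr)
    fix m m' assume std: "m \<in> standard_monomials" "m' \<in> standard_monomials"
      and "val m = val m'" and "m \<noteq> m'"
    then have "(\<Sum>n\<in>{m, m'}. \<iota> (if n = m then 1 else - 1) * val n) = 0"
      by (simp add: embed_one embed_uminus)
    then have "(if m = m then 1 else - 1 :: 'p group_ring) = 0"
      using std linear_relation_trivial[of "{m, m'}" "\<lambda>n. if n = m then 1 else - 1" m] by simp
    then show False by simp
  qed
  show "scalars.independent (val ` standard_monomials)"
  proof
    assume "scalars.dependent (val ` standard_monomials)"
    then obtain t u v where t: "finite t" "t \<subseteq> val ` standard_monomials"
      and relation: "(\<Sum>v\<in>t. \<iota> (u v) * v) = 0" and v: "v \<in> t" "u v \<noteq> 0"
      unfolding scalars.dependent_explicit by blast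
    obtain T where T: "T \<subseteq> standard_monomials" "finite T" "t = val ` T"
      using finite_subset_image[OF t] by blast
    have "(\<Sum>m\<in>T. \<iota> (u (val m)) * val m) = 0"
      using relation inj_on_subset[OF inj T(1)] by (simp add: T(3) sum.reindex)
    then show False
      using linear_relation_trivial[OF T(2,1), of "\<lambda>m. u (val m)"] v T(3) by blast
  qed
qed

end

section \<open>The characterization\<close>

theorem independent_iff_acyclic: "standard_monomials_independent \<iota> \<Sigma> \<longleftrightarrow> acyclic_seed \<Sigma>"
  using independent_imp_acyclic acyclic_imp_independent by blast

theorem basis_iff_independent:
  "standard_monomials_basis \<iota> \<Sigma> \<longleftrightarrow> standard_monomials_independent \<iota> \<Sigma>"
  by (simp add: standard_monomials_basis_def standard_monomials_span_lower_bound)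

end

theorem theorem1p16:
  fixes \<iota> :: "'p::ab_group_add group_ring \<Rightarrow> 'f::field"
    and \<Sigma> :: "('p, 'f, 'n::finite) seed_data"
  assumes "seed \<iota> \<Sigma>"
  shows "(standard_monomials_independent \<iota> \<Sigma> \<longleftrightarrow> acyclic_seed \<Sigma>) \<and>
         (standard_monomials_basis \<iota> \<Sigma> \<longleftrightarrow> acyclic_seed \<Sigma>)"
  using seed.independent_iff_acyclic[OF assms] seed.basis_iff_independent[OF assms] by simp

end
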